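(* Let $(\Xi,\rho,\theta,\Sigma)$ be a continuous groupoid action with $\Xi$ a strongly non-compact groupoid. Then one has $$\Sigma_{\rm fix}\subset\Sigma_{\rm per}\subset\Sigma_{\rm wper}\cap\Sigma_{\rm alper}\subset\Sigma_{\rm wper}\cup\Sigma_{\rm alper}\subset\Sigma_{\rm rec}\subset\bigcup_{\sigma\in\Sigma}\mathfrak L_\sigma\subset\Sigma_{\rm nw}.$$
   Context: All topological spaces are Hausdorff. A groupoid $\Xi$ is a small category in which all arrows are invertible; $X=\Xi^{(0)}$ is its unit space, $d,r:\Xi\to X$ are the source and range maps, and $\xi\eta$ is defined iff $d(\xi)=r(\eta)$. A topological groupoid is a groupoid with a (Hausdorff) topology making inversion and multiplication continuous (composable pairs carry the topology induced from $\Xi\times\Xi$); $X$ has the subspace topology. For $x\in X$, $\Xi_x=d^{-1}(\{x\})$. $\Xi$ is strongly non-compact if $\Xi_x$ is non-compact for every $x\in X$. For $\mathsf A,\mathsf B\subset\Xi$, $\mathsf A\mathsf B=\{\xi\eta:\xi\in\mathsf A,\ \eta\in\mathsf B,\ d(\xi)=r(\eta)\}$. A continuous groupoid action $(\Xi,\rho,\theta,\Sigma)$ consists of a topological groupoid $\Xi$, a Hausdorff space $\Sigma$, a continuous surjection $\rho:\Sigma\to X$ (the anchor) and a continuous map $\theta:\{(\xi,\sigma)\in\Xi\times\Sigma: d(\xi)=\rho(\sigma)\}\to\Sigma$, $\theta_\xi(\sigma)=\xi\bullet\sigma$, with $\rho(\sigma)\bullet\sigma=\sigma$ and: if $d(\xi)=r(\eta)$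 and $d(\eta)=\rho(\sigma)$ then $d(\xi)=\rho(\eta\bullet\sigma)$ and $(\xi\eta)\bullet\sigma=\xi\bullet(\eta\bullet\sigma)$. For $M,N\subset\Sigma$, $\xi\bullet M=\{\xi\bullet\sigma:\sigma\in M,\ \rho(\sigma)=d(\xi)\}$ and $\widetilde\Xi_M^N=\{\xi\in\Xi:(\xi\bullet M)\cap N\neq\emptyset\}$; singletons are written as points, so $\widetilde\Xi_\sigma^N=\{\xi\in\Xi_{\rho(\sigma)}:\xi\bullet\sigma\in N\}$ and $\widetilde\Xi_\sigma^\sigma$ is the stabilizer of $\sigma$. For $\mathsf A\subset\Xi$, $\mathsf A\bullet\sigma=\{\xi\bullet\sigma:\xi\in\mathsf A,\ d(\xi)=\rho(\sigma)\}$. The limit set of $\sigma$ is $\mathfrak L_\sigma=\bigcap_{\mathsf K}\overline{(\Xi\setminus\mathsf K)\bullet\sigma}$, over all compact $\mathsf K\subset\Xi$. A subset $\mathsf A\subset\Xi_x$ is syndetic (in $\Xi_x$) if $\mathsf K\mathsf A=\Xi_x$ for some compact $\mathsf K\subset\Xi$. The sets are: $\Sigma_{\rm fix}$, the fixed points ($\xi\bullet\sigma=\sigma$ for all $\xi\in\Xi_{\rho(\sigma)}$); $\Sigma_{\rm per}$, the periodic points ($\widetilde\Xi_\sigma^\sigma$ is syndetic in $\Xi_{\rho(\sigma)}$); $\Sigma_{\rm wper}$, the weakly periodic points ($\widetilde\Xi_\sigma^\sigma$ is not compact); $\Sigma_{\rm alper}$, the almost periodic points ($\widetilde\Xi_\sigma^U$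 is syndetic in $\Xi_{\rho(\sigma)}$ for every neighborhood $U$ of $\sigma$); $\Sigma_{\rm rec}$, the recurrent points ($\sigma\in\mathfrak L_\sigma$); $\Sigma_{\rm nw}$, the non-wandering points ($\sigma$ such that for no neighborhood $W$ of $\sigma$ is $\widetilde\Xi_W^W$ relatively compact, i.e. of compact closure). *)

theory Defs
  imports "HOL-Analysis.Analysis"
begin

text \<open>
  Spaces are abstract topologies, so neither the groupoid nor the space acted upon has to
  exhaust its type. The carrier of a groupoid is the \<^const>\<open>topspace\<close> of its topology. Objects
  are identified with their identity arrows, so source and range take values in the arrows.
\<close>

record 'g top_groupoid =
  gtop :: "'g topology"
  src :: "'g \<Rightarrow> 'g"
  rng :: "'g \<Rightarrow> 'g"
  gmult :: "'g \<Rightarrow> 'g \<Rightarrow> 'g"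
  ginv :: "'g \<Rightarrow> 'g"

definition arrows :: "'g top_groupoid \<Rightarrow> 'g set" where
  "arrows \<Xi> = topspace (gtop \<Xi>)"

definition unit_space :: "'g top_groupoid \<Rightarrow> 'g set" where
  "unit_space \<Xi> = src \<Xi> ` arrows \<Xi>"

locale groupoid =
  fixes \<Xi> :: "'g top_groupoid"
  assumes src_in: "\<xi> \<in> arrows \<Xi> \<Longrightarrow> src \<Xi> \<xi> \<in> arrows \<Xi>"
    and rng_in_units: "\<xi> \<in> arrows \<Xi> \<Longrightarrow> rng \<Xi> \<xi> \<in> unit_space \<Xi>"
    and src_unit: "x \<in> unit_space \<Xi> \<Longrightarrow> src \<Xi> x = x"
    and rng_unit: "x \<in> unit_space \<Xi> \<Longrightarrow> rng \<Xi> x = x"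
    and mult_in: "\<lbrakk>\<xi> \<in> arrows \<Xi>; \<eta> \<in> arrows \<Xi>; src \<Xi> \<xi> = rng \<Xi> \<eta>\<rbrakk>
      \<Longrightarrow> gmult \<Xi> \<xi> \<eta> \<in> arrows \<Xi>"
    and src_mult: "\<lbrakk>\<xi> \<in> arrows \<Xi>; \<eta> \<in> arrows \<Xi>; src \<Xi> \<xi> = rng \<Xi> \<eta>\<rbrakk>
      \<Longrightarrow> src \<Xi> (gmult \<Xi> \<xi> \<eta>) = src \<Xi> \<eta>"
    and rng_mult: "\<lbrakk>\<xi> \<in> arrows \<Xi>; \<eta> \<in> arrows \<Xi>; src \<Xi> \<xi> = rng \<Xi> \<eta>\<rbrakk>
      \<Longrightarrow> rng \<Xi> (gmult \<Xi> \<xi> \<eta>) = rng \<Xi> \<xi>"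
    and mult_assoc: "\<lbrakk>\<xi> \<in> arrows \<Xi>; \<eta> \<in> arrows \<Xi>; \<zeta> \<in> arrows \<Xi>;
        src \<Xi> \<xi> = rng \<Xi> \<eta>; src \<Xi> \<eta> = rng \<Xi> \<zeta>\<rbrakk>
      \<Longrightarrow> gmult \<Xi> (gmult \<Xi> \<xi> \<eta>) \<zeta> = gmult \<Xi> \<xi> (gmult \<Xi> \<eta> \<zeta>)"
    and mult_src: "\<xi> \<in> arrows \<Xi> \<Longrightarrow> gmult \<Xi> \<xi> (src \<Xi> \<xi>) = \<xi>"
    and rng_mult_self: "\<xi> \<in> arrows \<Xi> \<Longrightarrow> gmult \<Xi> (rng \<Xi> \<xi>) \<xi> = \<xi>"
    and inv_in: "\<xi> \<in> arrows \<Xi> \<Longrightarrow> ginv \<Xi> \<xi> \<in> arrows \<Xi>"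
    and src_inv: "\<xi> \<in> arrows \<Xi> \<Longrightarrow> src \<Xi> (ginv \<Xi> \<xi>) = rng \<Xi> \<xi>"
    and rng_inv: "\<xi> \<in> arrows \<Xi> \<Longrightarrow> rng \<Xi> (ginv \<Xi> \<xi>) = src \<Xi> \<xi>"
    and inv_mult: "\<xi> \<in> arrows \<Xi> \<Longrightarrow> gmult \<Xi> (ginv \<Xi> \<xi>) \<xi> = src \<Xi> \<xi>"
    and mult_inv: "\<xi> \<in> arrows \<Xi> \<Longrightarrow> gmult \<Xi> \<xi> (ginv \<Xi> \<xi>) = rng \<Xi> \<xi>"

locale topological_groupoid = groupoid +
  assumes Hausdorff_groupoid: "Hausdorff_space (gtop \<Xi>)"
    and continuous_inv: "continuous_map (gtop \<Xi>) (gtop \<Xi>) (ginv \<Xi>)"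
    and continuous_mult: "continuous_map
      (subtopology (prod_topology (gtop \<Xi>) (gtop \<Xi>)) {(\<xi>, \<eta>). src \<Xi> \<xi> = rng \<Xi> \<eta>})
      (gtop \<Xi>) (\<lambda>(\<xi>, \<eta>). gmult \<Xi> \<xi> \<eta>)"

definition src_fiber :: "'g top_groupoid \<Rightarrow> 'g \<Rightarrow> 'g set" where
  "src_fiber \<Xi> x = {\<xi> \<in> arrows \<Xi>. src \<Xi> \<xi> = x}"

definition strongly_non_compact :: "'g top_groupoid \<Rightarrow> bool" where
  "strongly_non_compact \<Xi> \<longleftrightarrow> (\<forall>x\<in>unit_space \<Xi>. \<not> compactin (gtop \<Xi>) (src_fiber \<Xi> x))"

definition set_mult :: "'g top_groupoid \<Rightarrow> 'g set \<Rightarrow> 'g set \<Rightarrow> 'g set" where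
  "set_mult \<Xi> A B = {gmult \<Xi> \<xi> \<eta> |\<xi> \<eta>. \<xi> \<in> A \<and> \<eta> \<in> B \<and> src \<Xi> \<xi> = rng \<Xi> \<eta>}"

definition syndetic :: "'g top_groupoid \<Rightarrow> 'g \<Rightarrow> 'g set \<Rightarrow> bool" where
  "syndetic \<Xi> x A \<longleftrightarrow>
    A \<subseteq> src_fiber \<Xi> x \<and> (\<exists>K. compactin (gtop \<Xi>) K \<and> set_mult \<Xi> K A = src_fiber \<Xi> x)"

locale continuous_groupoid_action = topological_groupoid \<Xi>
  for \<Xi> :: "'g top_groupoid" +
  fixes \<rho> :: "'s \<Rightarrow> 'g" and \<theta> :: "'g \<Rightarrow> 's \<Rightarrow> 's" and \<Sigma> :: "'s topology"
  assumes Hausdorff_action_space: "Hausdorff_space \<Sigma>"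
    and continuous_anchor: "continuous_map \<Sigma> (subtopology (gtop \<Xi>) (unit_space \<Xi>)) \<rho>"
    and anchor_surj: "\<rho> ` topspace \<Sigma> = unit_space \<Xi>"
    and continuous_act: "continuous_map
      (subtopology (prod_topology (gtop \<Xi>) \<Sigma>) {(\<xi>, \<sigma>). src \<Xi> \<xi> = \<rho> \<sigma>})
      \<Sigma> (\<lambda>(\<xi>, \<sigma>). \<theta> \<xi> \<sigma>)"
    and act_unit: "\<sigma> \<in> topspace \<Sigma> \<Longrightarrow> \<theta> (\<rho> \<sigma>) \<sigma> = \<sigma>"
    and anchor_act: "\<lbrakk>\<xi> \<in> arrows \<Xi>; \<eta> \<in> arrows \<Xi>; \<sigma> \<in> topspace \<Sigma>;
        src \<Xi> \<xi> = rng \<Xi> \<eta>; src \<Xi> \<eta> = \<rho> \<sigma>\<rbrakk> \<Longrightarrow> src \<Xi> \<xi> = \<rho> (\<theta> \<eta> \<sigma>)"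
    and act_mult: "\<lbrakk>\<xi> \<in> arrows \<Xi>; \<eta> \<in> arrows \<Xi>; \<sigma> \<in> topspace \<Sigma>;
        src \<Xi> \<xi> = rng \<Xi> \<eta>; src \<Xi> \<eta> = \<rho> \<sigma>\<rbrakk> \<Longrightarrow> \<theta> (gmult \<Xi> \<xi> \<eta>) \<sigma> = \<theta> \<xi> (\<theta> \<eta> \<sigma>)"

definition translate ::
  "'g top_groupoid \<Rightarrow> ('s \<Rightarrow> 'g) \<Rightarrow> ('g \<Rightarrow> 's \<Rightarrow> 's) \<Rightarrow> 'g \<Rightarrow> 's set \<Rightarrow> 's set" where
  "translate \<Xi> \<rho> \<theta> \<xi> M = {\<theta> \<xi> \<sigma> |\<sigma>. \<sigma> \<in> M \<and> \<rho> \<sigma> = src \<Xi> \<xi>}"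

definition transporter ::
  "'g top_groupoid \<Rightarrow> ('s \<Rightarrow> 'g) \<Rightarrow> ('g \<Rightarrow> 's \<Rightarrow> 's) \<Rightarrow> 's set \<Rightarrow> 's set \<Rightarrow> 'g set" where
  "transporter \<Xi> \<rho> \<theta> M N = {\<xi> \<in> arrows \<Xi>. translate \<Xi> \<rho> \<theta> \<xi> M \<inter> N \<noteq> {}}"

definition partial_orbit ::
  "'g top_groupoid \<Rightarrow> ('s \<Rightarrow> 'g) \<Rightarrow> ('g \<Rightarrow> 's \<Rightarrow> 's) \<Rightarrow> 'g set \<Rightarrow> 's \<Rightarrow> 's set" where
  "partial_orbit \<Xi> \<rho> \<theta> A \<sigma> = {\<theta> \<xi> \<sigma> |\<xi>. \<xi> \<in> A \<and> src \<Xi> \<xi> = \<rho> \<sigma>}"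

definition limit_set ::
  "'g top_groupoid \<Rightarrow> ('s \<Rightarrow> 'g) \<Rightarrow> ('g \<Rightarrow> 's \<Rightarrow> 's) \<Rightarrow> 's topology \<Rightarrow> 's \<Rightarrow> 's set" where
  "limit_set \<Xi> \<rho> \<theta> \<Sigma> \<sigma> =
    (\<Inter>K\<in>{K. compactin (gtop \<Xi>) K}. \<Sigma> closure_of partial_orbit \<Xi> \<rho> \<theta> (arrows \<Xi> - K) \<sigma>)"

text \<open>Neighborhoods need not be open.\<close>

definition neighborhood :: "'s topology \<Rightarrow> 's \<Rightarrow> 's set \<Rightarrow> bool" where
  "neighborhood \<Sigma> \<sigma> W \<longleftrightarrow> W \<subseteq> topspace \<Sigma> \<and> (\<exists>U. openin \<Sigma> U \<and> \<sigma> \<in> U \<and> U \<subseteq> W)"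

definition fixed_points ::
  "'g top_groupoid \<Rightarrow> ('s \<Rightarrow> 'g) \<Rightarrow> ('g \<Rightarrow> 's \<Rightarrow> 's) \<Rightarrow> 's topology \<Rightarrow> 's set" where
  "fixed_points \<Xi> \<rho> \<theta> \<Sigma> = {\<sigma> \<in> topspace \<Sigma>. \<forall>\<xi>\<in>src_fiber \<Xi> (\<rho> \<sigma>). \<theta> \<xi> \<sigma> = \<sigma>}"

definition periodic_points ::
  "'g top_groupoid \<Rightarrow> ('s \<Rightarrow> 'g) \<Rightarrow> ('g \<Rightarrow> 's \<Rightarrow> 's) \<Rightarrow> 's topology \<Rightarrow> 's set" where
  "periodic_points \<Xi> \<rho> \<theta> \<Sigma> =
    {\<sigma> \<in> topspace \<Sigma>. syndetic \<Xi> (\<rho> \<sigma>) (transporter \<Xi> \<rho> \<theta> {\<sigma>} {\<sigma>})}"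

definition weakly_periodic_points ::
  "'g top_groupoid \<Rightarrow> ('s \<Rightarrow> 'g) \<Rightarrow> ('g \<Rightarrow> 's \<Rightarrow> 's) \<Rightarrow> 's topology \<Rightarrow> 's set" where
  "weakly_periodic_points \<Xi> \<rho> \<theta> \<Sigma> =
    {\<sigma> \<in> topspace \<Sigma>. \<not> compactin (gtop \<Xi>) (transporter \<Xi> \<rho> \<theta> {\<sigma>} {\<sigma>})}"

definition almost_periodic_points ::
  "'g top_groupoid \<Rightarrow> ('s \<Rightarrow> 'g) \<Rightarrow> ('g \<Rightarrow> 's \<Rightarrow> 's) \<Rightarrow> 's topology \<Rightarrow> 's set" where
  "almost_periodic_points \<Xi> \<rho> \<theta> \<Sigma> =
    {\<sigma> \<in> topspace \<Sigma>. \<forall>U. neighborhood \<Sigma> \<sigma> U \<longrightarrow> syndetic \<Xi> (\<rho> \<sigma>) (transporter \<Xi> \<rho> \<theta> {\<sigma>} U)}"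

definition recurrent_points ::
  "'g top_groupoid \<Rightarrow> ('s \<Rightarrow> 'g) \<Rightarrow> ('g \<Rightarrow> 's \<Rightarrow> 's) \<Rightarrow> 's topology \<Rightarrow> 's set" where
  "recurrent_points \<Xi> \<rho> \<theta> \<Sigma> = {\<sigma> \<in> topspace \<Sigma>. \<sigma> \<in> limit_set \<Xi> \<rho> \<theta> \<Sigma> \<sigma>}"

definition nonwandering_points ::
  "'g top_groupoid \<Rightarrow> ('s \<Rightarrow> 'g) \<Rightarrow> ('g \<Rightarrow> 's \<Rightarrow> 's) \<Rightarrow> 's topology \<Rightarrow> 's set" where
  "nonwandering_points \<Xi> \<rho> \<theta> \<Sigma> =
    {\<sigma> \<in> topspace \<Sigma>. \<not> (\<exists>W. neighborhood \<Sigma> \<sigma> W \<and>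
      compactin (gtop \<Xi>) (gtop \<Xi> closure_of transporter \<Xi> \<rho> \<theta> W W))}"

end

theory Submission
  imports Defs
begin

text \<open>
  Three facts carry the chain of inclusions.

  First, the product of two compact sets of arrows is compact. Source and range are continuous
  with Hausdorff target, so the composable pairs form a closed set of pairs, and the product is
  the continuous image of a closed part of a compact rectangle. Consequently a source fiber that
  is not compact has no relatively compact syndetic subset: if \<open>K A\<close> is the whole fiber and
  \<open>A\<close> lies in a compact set \<open>L\<close>, then the fiber is a closed subset of the compact set \<open>K L\<close>.

  Second, a point \<open>\<tau>\<close> belongs to the limit set of \<open>\<sigma>\<close> exactly if, for every open neighborhood
  \<open>U\<close> of \<open>\<tau>\<close>, the set of arrows that carry \<open>\<sigma>\<close> into \<open>U\<close> is contained in no compact set. This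
  turns recurrence into a question about return times. For weakly periodic points the return
  times include the stabilizer, which is closed but not compact; for almost periodic points they
  are syndetic and the first fact applies. The first fact also shows that periodic points are
  weakly periodic.

  Third, if \<open>\<xi>\<close> and \<open>\<eta>\<close> carry \<open>\<sigma>\<close> into \<open>U\<close>, then \<open>\<xi> \<eta>\<inverse>\<close> carries a point of \<open>U\<close> into \<open>U\<close>. So
  if the transporter of \<open>U\<close> into itself lies in a compact set \<open>C\<close>, then all arrows that carry
  \<open>\<sigma>\<close> into \<open>U\<close> lie in the compact set \<open>C \<eta>\<close>, and no point of \<open>U\<close> is in the limit set of \<open>\<sigma>\<close>.
\<close>

section \<open>Compact sets of arrows\<close>

context groupoid
begin

lemma unit_in_arrows: "x \<in> unit_space \<Xi> \<Longrightarrow> x \<in> arrows \<Xi>"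
  unfolding unit_space_def using src_in by auto

lemma rng_in: "\<xi> \<in> arrows \<Xi> \<Longrightarrow> rng \<Xi> \<xi> \<in> arrows \<Xi>"
  using rng_in_units unit_in_arrows by blast

lemma set_mult_mono:
  assumes "A \<subseteq> A'" and "B \<subseteq> B'"
  shows "set_mult \<Xi> A B \<subseteq> set_mult \<Xi> A' B'"
  unfolding set_mult_def using assms by blast

lemma set_mult_src_fiber:
  assumes "K \<subseteq> arrows \<Xi>" and "A \<subseteq> src_fiber \<Xi> x"
  shows "set_mult \<Xi> K A \<subseteq> src_fiber \<Xi> x"
  unfolding set_mult_def
proof clarify
  fix \<xi> \<eta> assume "\<xi> \<in> K" "\<eta> \<in> A" and composable: "src \<Xi> \<xi> = rng \<Xi> \<eta>"
  then have "\<xi> \<in> arrows \<Xi>" "\<eta> \<in> arrows \<Xi>" "src \<Xi> \<eta> = x"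
    using assms by (auto simp: src_fiber_def)
  then show "gmult \<Xi> \<xi> \<eta> \<in> src_fiber \<Xi> x"
    using composable by (simp add: src_fiber_def mult_in src_mult)
qed

lemma syndetic_superset:
  assumes "syndetic \<Xi> x A" and "A \<subseteq> B" and "B \<subseteq> src_fiber \<Xi> x"
  shows "syndetic \<Xi> x B"
proof -
  obtain K where K: "compactin (gtop \<Xi>) K" "set_mult \<Xi> K A = src_fiber \<Xi> x"
    using assms(1) unfolding syndetic_def by blast
  have "K \<subseteq> arrows \<Xi>"
    using K(1) compactin_subset_topspace unfolding arrows_def by blast
  then have "set_mult \<Xi> K B \<subseteq> src_fiber \<Xi> x"
    using assms(3) by (rule set_mult_src_fiber)
  moreover have "src_fiber \<Xi> x \<subseteq> set_mult \<Xi> K B"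
    using set_mult_mono[OF order_refl assms(2), of K] K(2) by simp
  ultimately show ?thesis
    unfolding syndetic_def using K(1) assms(3) by blast
qed

end

context topological_groupoid
begin

text \<open>Source and range are continuous because they are \<open>\<xi>\<inverse> \<xi>\<close> and \<open>\<xi> \<xi>\<inverse>\<close>.\<close>

lemma continuous_src: "continuous_map (gtop \<Xi>) (gtop \<Xi>) (src \<Xi>)"
proof -
  have "continuous_map (gtop \<Xi>)
      (subtopology (prod_topology (gtop \<Xi>) (gtop \<Xi>)) {(\<xi>, \<eta>). src \<Xi> \<xi> = rng \<Xi> \<eta>})
      (\<lambda>\<xi>. (ginv \<Xi> \<xi>, \<xi>))"
    using continuous_inv src_inv
    by (auto simp: continuous_map_in_subtopology continuous_map_pairedI arrows_def)
  from continuous_map_compose[OF this continuous_mult] show ?thesis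
    by (rule continuous_map_eq) (simp add: inv_mult arrows_def)
qed

lemma continuous_rng: "continuous_map (gtop \<Xi>) (gtop \<Xi>) (rng \<Xi>)"
proof -
  have "continuous_map (gtop \<Xi>) (gtop \<Xi>) (src \<Xi> \<circ> ginv \<Xi>)"
    using continuous_inv continuous_src by (rule continuous_map_compose)
  then show ?thesis
    by (rule continuous_map_eq) (simp add: src_inv arrows_def)
qed

lemma closedin_src_fiber:
  assumes "x \<in> arrows \<Xi>"
  shows "closedin (gtop \<Xi>) (src_fiber \<Xi> x)"
proof -
  have "closedin (gtop \<Xi>) {\<xi> \<in> topspace (gtop \<Xi>). src \<Xi> \<xi> = x}"
    using closedin_continuous_maps_eq[OF Hausdorff_groupoid continuous_src, of "\<lambda>_. x"] assms
    by (simp add: arrows_def)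
  then show ?thesis
    by (simp add: src_fiber_def arrows_def)
qed

lemma closedin_composable:
  "closedin (prod_topology (gtop \<Xi>) (gtop \<Xi>))
    {p \<in> topspace (prod_topology (gtop \<Xi>) (gtop \<Xi>)). src \<Xi> (fst p) = rng \<Xi> (snd p)}"
  using Hausdorff_groupoid
    continuous_map_compose[OF continuous_map_fst continuous_src, unfolded o_def]
    continuous_map_compose[OF continuous_map_snd continuous_rng, unfolded o_def]
  by (rule closedin_continuous_maps_eq)

text \<open>
  Multiplication is defined on composable pairs only, so compactness of the rectangle has to be
  passed on to its composable part, which is closed since the groupoid is Hausdorff.
\<close>

lemma compactin_set_mult:
  assumes "compactin (gtop \<Xi>) K" and "compactin (gtop \<Xi>) L"
  shows "compactin (gtop \<Xi>) (set_mult \<Xi> K L)"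
proof -
  let ?P = "prod_topology (gtop \<Xi>) (gtop \<Xi>)"
  let ?D = "{(\<xi>, \<eta>). src \<Xi> \<xi> = rng \<Xi> \<eta>}"
  have "K \<times> L \<subseteq> topspace ?P"
    using assms[THEN compactin_subset_topspace] by auto
  then have composable_part:
    "{p \<in> topspace ?P. src \<Xi> (fst p) = rng \<Xi> (snd p)} \<inter> K \<times> L = (K \<times> L) \<inter> ?D"
    by (simp add: set_eq_iff subset_iff) blast
  have "compactin ?P (K \<times> L)"
    using assms by (simp add: compactin_Times)
  from closed_Int_compactin[OF closedin_composable this]
  have "compactin ?P ((K \<times> L) \<inter> ?D)"
    unfolding composable_part .
  then have "compactin (subtopology ?P ?D) ((K \<times> L) \<inter> ?D)"
    by (simp add: compactin_subtopology)
  then have "compactin (gtop \<Xi>) ((\<lambda>(\<xi>, \<eta>). gmult \<Xi> \<xi> \<eta>) ` ((K \<times> L) \<inter> ?D))"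
    using continuous_mult by (rule image_compactin)
  moreover have "(\<lambda>(\<xi>, \<eta>). gmult \<Xi> \<xi> \<eta>) ` ((K \<times> L) \<inter> ?D) = set_mult \<Xi> K L"
    unfolding set_mult_def by force
  ultimately show ?thesis
    by simp
qed

lemma syndetic_within_compact_imp_compact_fiber:
  assumes "x \<in> arrows \<Xi>" and "syndetic \<Xi> x A"
    and "A \<subseteq> L" and "compactin (gtop \<Xi>) L"
  shows "compactin (gtop \<Xi>) (src_fiber \<Xi> x)"
proof -
  obtain K where K: "compactin (gtop \<Xi>) K" "set_mult \<Xi> K A = src_fiber \<Xi> x"
    using assms(2) unfolding syndetic_def by blast
  have "src_fiber \<Xi> x \<subseteq> set_mult \<Xi> K L"
    using set_mult_mono[OF order_refl assms(3), of K] K(2) by simp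
  with compactin_set_mult[OF K(1) assms(4)] show ?thesis
    using closedin_src_fiber[OF assms(1)] by (rule closed_compactin)
qed

end

section \<open>Transporters and limit sets\<close>

context continuous_groupoid_action
begin

lemma anchor_in_units: "\<sigma> \<in> topspace \<Sigma> \<Longrightarrow> \<rho> \<sigma> \<in> unit_space \<Xi>"
  using anchor_surj by blast

lemma anchor_act_eq_rng:
  assumes "\<xi> \<in> arrows \<Xi>" and "\<sigma> \<in> topspace \<Sigma>" and "src \<Xi> \<xi> = \<rho> \<sigma>"
  shows "\<rho> (\<theta> \<xi> \<sigma>) = rng \<Xi> \<xi>"
  \<comment> \<open>The anchor axiom speaks of a second arrow; the unit at the range of \<open>\<xi>\<close> serves.\<close>
  using anchor_act[of "rng \<Xi> \<xi>" \<xi> \<sigma>] assms by (simp add: rng_in src_unit rng_in_units)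

lemma transporter_point:
  "transporter \<Xi> \<rho> \<theta> {\<sigma>} N = {\<xi> \<in> src_fiber \<Xi> (\<rho> \<sigma>). \<theta> \<xi> \<sigma> \<in> N}"
  unfolding transporter_def translate_def src_fiber_def by auto

lemma transporter_point_subset_fiber:
  "transporter \<Xi> \<rho> \<theta> {\<sigma>} N \<subseteq> src_fiber \<Xi> (\<rho> \<sigma>)"
  by (auto simp: transporter_point)

lemma transporter_mono:
  assumes "M \<subseteq> M'" and "N \<subseteq> N'"
  shows "transporter \<Xi> \<rho> \<theta> M N \<subseteq> transporter \<Xi> \<rho> \<theta> M' N'"
  using assms unfolding transporter_def translate_def by blast

text \<open>
  The orbit map of a point is continuous on the source fiber, so the arrows carrying the point
  into a closed set are closed in that fiber, which is itself closed.
\<close>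

lemma closedin_transporter_point:
  assumes "\<sigma> \<in> topspace \<Sigma>" and "closedin \<Sigma> N"
  shows "closedin (gtop \<Xi>) (transporter \<Xi> \<rho> \<theta> {\<sigma>} N)"
proof -
  let ?F = "src_fiber \<Xi> (\<rho> \<sigma>)"
  have "continuous_map (subtopology (gtop \<Xi>) ?F)
      (subtopology (prod_topology (gtop \<Xi>) \<Sigma>) {(\<xi>, \<tau>). src \<Xi> \<xi> = \<rho> \<tau>}) (\<lambda>\<xi>. (\<xi>, \<sigma>))"
    using assms(1)
    by (auto simp: continuous_map_in_subtopology continuous_map_pairedI
        continuous_map_from_subtopology src_fiber_def)
  from continuous_map_compose[OF this continuous_act]
  have "continuous_map (subtopology (gtop \<Xi>) ?F) \<Sigma> (\<lambda>\<xi>. \<theta> \<xi> \<sigma>)"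
    by (simp add: o_def)
  then have "closedin (subtopology (gtop \<Xi>) ?F)
      {\<xi> \<in> topspace (subtopology (gtop \<Xi>) ?F). \<theta> \<xi> \<sigma> \<in> N}"
    using assms(2) by (rule closedin_continuous_map_preimage)
  moreover have "{\<xi> \<in> topspace (subtopology (gtop \<Xi>) ?F). \<theta> \<xi> \<sigma> \<in> N}
      = transporter \<Xi> \<rho> \<theta> {\<sigma>} N"
    by (auto simp: transporter_point src_fiber_def arrows_def)
  moreover have "closedin (gtop \<Xi>) ?F"
    using assms(1) anchor_in_units unit_in_arrows closedin_src_fiber by blast
  ultimately show ?thesis
    using closedin_closed_subtopology[of "gtop \<Xi>" ?F] by simp
qed

text \<open>
  An open set meets the closure of \<open>(\<Xi> - K) \<bullet> \<sigma>\<close> exactly if it meets that set itself, that is, if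
  some arrow outside \<open>K\<close> carries \<open>\<sigma>\<close> into the open set.
\<close>

lemma limit_set_iff:
  "\<tau> \<in> limit_set \<Xi> \<rho> \<theta> \<Sigma> \<sigma> \<longleftrightarrow> \<tau> \<in> topspace \<Sigma> \<and>
    (\<forall>K U. compactin (gtop \<Xi>) K \<longrightarrow> openin \<Sigma> U \<longrightarrow> \<tau> \<in> U \<longrightarrow>
      \<not> transporter \<Xi> \<rho> \<theta> {\<sigma>} U \<subseteq> K)"
proof -
  have "(\<exists>y. y \<in> partial_orbit \<Xi> \<rho> \<theta> (arrows \<Xi> - K) \<sigma> \<and> y \<in> U)
      \<longleftrightarrow> \<not> transporter \<Xi> \<rho> \<theta> {\<sigma>} U \<subseteq> K" for K U
    unfolding partial_orbit_def transporter_point src_fiber_def by blast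
  then have member: "\<tau> \<in> \<Sigma> closure_of partial_orbit \<Xi> \<rho> \<theta> (arrows \<Xi> - K) \<sigma> \<longleftrightarrow>
      \<tau> \<in> topspace \<Sigma> \<and> (\<forall>U. \<tau> \<in> U \<and> openin \<Sigma> U \<longrightarrow> \<not> transporter \<Xi> \<rho> \<theta> {\<sigma>} U \<subseteq> K)" for K
    by (simp only: in_closure_of)
  \<comment> \<open>The empty compact set keeps the intersection inside the space.\<close>
  have "compactin (gtop \<Xi>) {}"
    by simp
  then have "{K. compactin (gtop \<Xi>) K} \<noteq> {}"
    by blast
  then show ?thesis
    unfolding limit_set_def INT_iff member by auto
qed

text \<open>
  Going back from \<open>\<eta> \<bullet> \<sigma>\<close> to \<open>\<sigma>\<close> and then on to \<open>\<xi> \<bullet> \<sigma>\<close> leads from \<open>U\<close> to \<open>U\<close>. Hence all arrows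
  \<open>\<xi>\<close> that carry \<open>\<sigma>\<close> into \<open>U\<close> are obtained from self-transporters of \<open>U\<close> by right translation with the single arrow \<open>\<eta>\<close>.
\<close>

lemma transporter_point_subset_translate:
  assumes "\<sigma> \<in> topspace \<Sigma>" and "\<eta> \<in> transporter \<Xi> \<rho> \<theta> {\<sigma>} U"
  shows "transporter \<Xi> \<rho> \<theta> {\<sigma>} U \<subseteq> set_mult \<Xi> (transporter \<Xi> \<rho> \<theta> U U) {\<eta>}"
proof
  fix \<xi> assume "\<xi> \<in> transporter \<Xi> \<rho> \<theta> {\<sigma>} U"
  then have \<xi>: "\<xi> \<in> arrows \<Xi>" "src \<Xi> \<xi> = \<rho> \<sigma>" "\<theta> \<xi> \<sigma> \<in> U"
    by (auto simp: transporter_point src_fiber_def)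
  have \<eta>: "\<eta> \<in> arrows \<Xi>" "src \<Xi> \<eta> = \<rho> \<sigma>" "\<theta> \<eta> \<sigma> \<in> U"
    using assms(2) by (auto simp: transporter_point src_fiber_def)
  let ?\<zeta> = "gmult \<Xi> \<xi> (ginv \<Xi> \<eta>)"
  have inv: "ginv \<Xi> \<eta> \<in> arrows \<Xi>" "rng \<Xi> (ginv \<Xi> \<eta>) = src \<Xi> \<xi>"
    "src \<Xi> (ginv \<Xi> \<eta>) = rng \<Xi> \<eta>"
    using \<xi> \<eta> by (simp_all add: inv_in rng_inv src_inv)
  have \<zeta>: "?\<zeta> \<in> arrows \<Xi>" "src \<Xi> ?\<zeta> = rng \<Xi> \<eta>"
    using \<xi> inv by (simp_all add: mult_in src_mult)
  have "gmult \<Xi> ?\<zeta> \<eta> = gmult \<Xi> \<xi> (gmult \<Xi> (ginv \<Xi> \<eta>) \<eta>)"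
    using \<xi> \<eta> inv by (intro mult_assoc) simp_all
  also have "\<dots> = \<xi>"
    using \<xi> \<eta> mult_src[of \<xi>] by (simp add: inv_mult)
  finally have factor: "gmult \<Xi> ?\<zeta> \<eta> = \<xi>" .
  have "\<theta> ?\<zeta> (\<theta> \<eta> \<sigma>) = \<theta> \<xi> \<sigma>"
    using act_mult[OF \<zeta>(1) \<eta>(1) assms(1) \<zeta>(2) \<eta>(2)] factor by simp
  moreover have "\<rho> (\<theta> \<eta> \<sigma>) = src \<Xi> ?\<zeta>"
    using \<zeta>(2) \<eta> assms(1) by (simp add: anchor_act_eq_rng)
  ultimately have "\<theta> \<xi> \<sigma> \<in> translate \<Xi> \<rho> \<theta> ?\<zeta> U"
    unfolding translate_def using \<eta>(3) by force
  then have "?\<zeta> \<in> transporter \<Xi> \<rho> \<theta> U U"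
    unfolding transporter_def using \<zeta>(1) \<xi>(3) by blast
  then show "\<xi> \<in> set_mult \<Xi> (transporter \<Xi> \<rho> \<theta> U U) {\<eta>}"
    unfolding set_mult_def using factor \<zeta>(2) by force
qed

section \<open>Comparison of the recurrence properties\<close>

text \<open>
  At a fixed point every arrow of the source fiber is a loop, by equivariance of the anchor. The
  fiber is therefore its own product with the one-point set of the unit; without the loop property
  arrows with a different range would be lost.
\<close>

lemma fixed_imp_periodic:
  "fixed_points \<Xi> \<rho> \<theta> \<Sigma> \<subseteq> periodic_points \<Xi> \<rho> \<theta> \<Sigma>"
proof
  fix \<sigma> assume "\<sigma> \<in> fixed_points \<Xi> \<rho> \<theta> \<Sigma>"
  then have \<sigma>: "\<sigma> \<in> topspace \<Sigma>"
    and fixed: "\<And>\<xi>. \<xi> \<in> src_fiber \<Xi> (\<rho> \<sigma>) \<Longrightarrow> \<theta> \<xi> \<sigma> = \<sigma>"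
    unfolding fixed_points_def by auto
  let ?F = "src_fiber \<Xi> (\<rho> \<sigma>)"
  have stabilizer: "transporter \<Xi> \<rho> \<theta> {\<sigma>} {\<sigma>} = ?F"
    using fixed by (auto simp: transporter_point)
  have unit: "\<rho> \<sigma> \<in> arrows \<Xi>" "src \<Xi> (\<rho> \<sigma>) = \<rho> \<sigma>"
    using \<sigma> anchor_in_units unit_in_arrows src_unit by blast+
  have loop: "rng \<Xi> \<xi> = \<rho> \<sigma>" if "\<xi> \<in> ?F" for \<xi>
    using anchor_act_eq_rng[of \<xi> \<sigma>] fixed[OF that] that \<sigma> by (simp add: src_fiber_def)
  have "set_mult \<Xi> {\<rho> \<sigma>} ?F \<subseteq> ?F"
    using unit by (intro set_mult_src_fiber) simp_all
  moreover have "?F \<subseteq> set_mult \<Xi> {\<rho> \<sigma>} ?F"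
  proof
    fix \<xi> assume \<xi>: "\<xi> \<in> ?F"
    then have "gmult \<Xi> (\<rho> \<sigma>) \<xi> = \<xi>"
      using loop[OF \<xi>] rng_mult_self[of \<xi>] by (simp add: src_fiber_def)
    then show "\<xi> \<in> set_mult \<Xi> {\<rho> \<sigma>} ?F"
      unfolding set_mult_def using \<xi> loop[OF \<xi>] unit by force
  qed
  moreover have "compactin (gtop \<Xi>) {\<rho> \<sigma>}"
    using unit(1) by (simp add: arrows_def)
  ultimately have "syndetic \<Xi> (\<rho> \<sigma>) ?F"
    unfolding syndetic_def by blast
  then show "\<sigma> \<in> periodic_points \<Xi> \<rho> \<theta> \<Sigma>"
    unfolding periodic_points_def using \<sigma> stabilizer by simp
qed

lemma periodic_imp_almost_periodic:
  "periodic_points \<Xi> \<rho> \<theta> \<Sigma> \<subseteq> almost_periodic_points \<Xi> \<rho> \<theta> \<Sigma>"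
proof
  fix \<sigma> assume "\<sigma> \<in> periodic_points \<Xi> \<rho> \<theta> \<Sigma>"
  then have \<sigma>: "\<sigma> \<in> topspace \<Sigma>" "syndetic \<Xi> (\<rho> \<sigma>) (transporter \<Xi> \<rho> \<theta> {\<sigma>} {\<sigma>})"
    unfolding periodic_points_def by auto
  have "syndetic \<Xi> (\<rho> \<sigma>) (transporter \<Xi> \<rho> \<theta> {\<sigma>} U)" if "neighborhood \<Sigma> \<sigma> U" for U
  proof -
    have "{\<sigma>} \<subseteq> U"
      using that unfolding neighborhood_def by blast
    from transporter_mono[OF order_refl this] show ?thesis
      using transporter_point_subset_fiber by (rule syndetic_superset[OF \<sigma>(2)])
  qed
  then show "\<sigma> \<in> almost_periodic_points \<Xi> \<rho> \<theta> \<Sigma>"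
    unfolding almost_periodic_points_def using \<sigma>(1) by blast
qed

lemma weakly_periodic_imp_recurrent:
  "weakly_periodic_points \<Xi> \<rho> \<theta> \<Sigma> \<subseteq> recurrent_points \<Xi> \<rho> \<theta> \<Sigma>"
proof
  fix \<sigma> assume "\<sigma> \<in> weakly_periodic_points \<Xi> \<rho> \<theta> \<Sigma>"
  then have \<sigma>: "\<sigma> \<in> topspace \<Sigma>"
    and noncompact: "\<not> compactin (gtop \<Xi>) (transporter \<Xi> \<rho> \<theta> {\<sigma>} {\<sigma>})"
    unfolding weakly_periodic_points_def by auto
  have closed: "closedin (gtop \<Xi>) (transporter \<Xi> \<rho> \<theta> {\<sigma>} {\<sigma>})"
    using \<sigma> closedin_Hausdorff_singleton[OF Hausdorff_action_space]
    by (intro closedin_transporter_point) auto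
  have "\<not> transporter \<Xi> \<rho> \<theta> {\<sigma>} U \<subseteq> K"
    if "compactin (gtop \<Xi>) K" "\<sigma> \<in> U" for K U
  proof
    assume "transporter \<Xi> \<rho> \<theta> {\<sigma>} U \<subseteq> K"
    then have "transporter \<Xi> \<rho> \<theta> {\<sigma>} {\<sigma>} \<subseteq> K"
      using that(2) by (auto simp: transporter_point)
    then show False
      using closed_compactin[OF that(1) _ closed] noncompact by blast
  qed
  then show "\<sigma> \<in> recurrent_points \<Xi> \<rho> \<theta> \<Sigma>"
    unfolding recurrent_points_def using \<sigma> by (simp add: limit_set_iff)
qed

lemma syndetic_imp_not_within_compact:
  assumes "strongly_non_compact \<Xi>" and "\<sigma> \<in> topspace \<Sigma>"
    and "syndetic \<Xi> (\<rho> \<sigma>) A" and "compactin (gtop \<Xi>) L"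
  shows "\<not> A \<subseteq> L"
proof
  assume "A \<subseteq> L"
  moreover have unit: "\<rho> \<sigma> \<in> unit_space \<Xi>"
    using assms(2) by (rule anchor_in_units)
  ultimately have "compactin (gtop \<Xi>) (src_fiber \<Xi> (\<rho> \<sigma>))"
    using syndetic_within_compact_imp_compact_fiber assms(3,4) unit_in_arrows by blast
  then show False
    using assms(1) unit unfolding strongly_non_compact_def by blast
qed

lemma periodic_imp_weakly_periodic:
  assumes "strongly_non_compact \<Xi>"
  shows "periodic_points \<Xi> \<rho> \<theta> \<Sigma> \<subseteq> weakly_periodic_points \<Xi> \<rho> \<theta> \<Sigma>"
  unfolding periodic_points_def weakly_periodic_points_def
  using syndetic_imp_not_within_compact[OF assms] by blast

lemma almost_periodic_imp_recurrent:
  assumes "strongly_non_compact \<Xi>"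
  shows "almost_periodic_points \<Xi> \<rho> \<theta> \<Sigma> \<subseteq> recurrent_points \<Xi> \<rho> \<theta> \<Sigma>"
proof
  fix \<sigma> assume "\<sigma> \<in> almost_periodic_points \<Xi> \<rho> \<theta> \<Sigma>"
  then have \<sigma>: "\<sigma> \<in> topspace \<Sigma>"
    and return: "\<And>U. neighborhood \<Sigma> \<sigma> U \<Longrightarrow> syndetic \<Xi> (\<rho> \<sigma>) (transporter \<Xi> \<rho> \<theta> {\<sigma>} U)"
    unfolding almost_periodic_points_def by auto
  have "\<not> transporter \<Xi> \<rho> \<theta> {\<sigma>} U \<subseteq> K"
    if "compactin (gtop \<Xi>) K" "openin \<Sigma> U" "\<sigma> \<in> U" for K U
  proof -
    have "neighborhood \<Sigma> \<sigma> U"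
      unfolding neighborhood_def using that openin_subset by blast
    then show ?thesis
      using syndetic_imp_not_within_compact[OF assms \<sigma> return that(1)] by blast
  qed
  then show "\<sigma> \<in> recurrent_points \<Xi> \<rho> \<theta> \<Sigma>"
    unfolding recurrent_points_def using \<sigma> by (simp add: limit_set_iff)
qed

lemma limit_set_subset_nonwandering:
  assumes "\<sigma> \<in> topspace \<Sigma>"
  shows "limit_set \<Xi> \<rho> \<theta> \<Sigma> \<sigma> \<subseteq> nonwandering_points \<Xi> \<rho> \<theta> \<Sigma>"
proof
  fix \<tau> assume "\<tau> \<in> limit_set \<Xi> \<rho> \<theta> \<Sigma> \<sigma>"
  then have \<tau>: "\<tau> \<in> topspace \<Sigma>"
    and escape: "\<And>K U. \<lbrakk>compactin (gtop \<Xi>) K; openin \<Sigma> U; \<tau> \<in> U\<rbrakk>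
      \<Longrightarrow> \<not> transporter \<Xi> \<rho> \<theta> {\<sigma>} U \<subseteq> K"
    unfolding limit_set_iff by blast+
  have "\<not> compactin (gtop \<Xi>) (gtop \<Xi> closure_of transporter \<Xi> \<rho> \<theta> W W)"
    if "neighborhood \<Sigma> \<tau> W" for W
  proof
    let ?C = "gtop \<Xi> closure_of transporter \<Xi> \<rho> \<theta> W W"
    assume "compactin (gtop \<Xi>) ?C"
    obtain U where U: "openin \<Sigma> U" "\<tau> \<in> U" "U \<subseteq> W"
      using \<open>neighborhood \<Sigma> \<tau> W\<close> unfolding neighborhood_def by blast
    \<comment> \<open>Leaving the empty compact set already yields one arrow carrying \<open>\<sigma>\<close> into \<open>U\<close>.\<close>
    obtain \<eta> where \<eta>: "\<eta> \<in> transporter \<Xi> \<rho> \<theta> {\<sigma>} U"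
      using escape[OF _ U(1,2), of "{}"] by auto
    have "\<eta> \<in> topspace (gtop \<Xi>)"
      using \<eta> by (auto simp: transporter_def arrows_def)
    then have "compactin (gtop \<Xi>) (set_mult \<Xi> ?C {\<eta>})"
      using \<open>compactin (gtop \<Xi>) ?C\<close> by (intro compactin_set_mult) simp_all
    moreover have "transporter \<Xi> \<rho> \<theta> {\<sigma>} U \<subseteq> set_mult \<Xi> ?C {\<eta>}"
    proof -
      have "transporter \<Xi> \<rho> \<theta> W W \<subseteq> ?C"
        by (rule closure_of_subset) (auto simp: transporter_def arrows_def)
      then have "transporter \<Xi> \<rho> \<theta> U U \<subseteq> ?C"
        using transporter_mono[OF U(3) U(3)] by blast
      from set_mult_mono[OF this order_refl] show ?thesis
        by (rule order_trans[OF transporter_point_subset_translate[OF assms \<eta>]])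
    qed
    ultimately show False
      using escape U(1,2) by blast
  qed
  then show "\<tau> \<in> nonwandering_points \<Xi> \<rho> \<theta> \<Sigma>"
    unfolding nonwandering_points_def using \<tau> by blast
qed

end

theorem proposition6p12:
  fixes \<Xi> :: "'g top_groupoid"
    and \<rho> :: "'s \<Rightarrow> 'g" and \<theta> :: "'g \<Rightarrow> 's \<Rightarrow> 's" and \<Sigma> :: "'s topology"
  assumes "continuous_groupoid_action \<Xi> \<rho> \<theta> \<Sigma>"
    and "strongly_non_compact \<Xi>"
  shows "fixed_points \<Xi> \<rho> \<theta> \<Sigma> \<subseteq> periodic_points \<Xi> \<rho> \<theta> \<Sigma>
    \<and> periodic_points \<Xi> \<rho> \<theta> \<Sigma>
        \<subseteq> weakly_periodic_points \<Xi> \<rho> \<theta> \<Sigma> \<inter> almost_periodic_points \<Xi> \<rho> \<theta> \<Sigma>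
    \<and> weakly_periodic_points \<Xi> \<rho> \<theta> \<Sigma> \<inter> almost_periodic_points \<Xi> \<rho> \<theta> \<Sigma>
        \<subseteq> weakly_periodic_points \<Xi> \<rho> \<theta> \<Sigma> \<union> almost_periodic_points \<Xi> \<rho> \<theta> \<Sigma>
    \<and> weakly_periodic_points \<Xi> \<rho> \<theta> \<Sigma> \<union> almost_periodic_points \<Xi> \<rho> \<theta> \<Sigma>
        \<subseteq> recurrent_points \<Xi> \<rho> \<theta> \<Sigma>
    \<and> recurrent_points \<Xi> \<rho> \<theta> \<Sigma> \<subseteq> (\<Union>\<sigma>\<in>topspace \<Sigma>. limit_set \<Xi> \<rho> \<theta> \<Sigma> \<sigma>)
    \<and> (\<Union>\<sigma>\<in>topspace \<Sigma>. limit_set \<Xi> \<rho> \<theta> \<Sigma> \<sigma>) \<subseteq> nonwandering_points \<Xi> \<rho> \<theta> \<Sigma>"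
proof -
  interpret continuous_groupoid_action \<Xi> \<rho> \<theta> \<Sigma>
    by (rule assms(1))
  have "recurrent_points \<Xi> \<rho> \<theta> \<Sigma> \<subseteq> (\<Union>\<sigma>\<in>topspace \<Sigma>. limit_set \<Xi> \<rho> \<theta> \<Sigma> \<sigma>)"
    unfolding recurrent_points_def by blast
  moreover have "(\<Union>\<sigma>\<in>topspace \<Sigma>. limit_set \<Xi> \<rho> \<theta> \<Sigma> \<sigma>) \<subseteq> nonwandering_points \<Xi> \<rho> \<theta> \<Sigma>"
    using limit_set_subset_nonwandering by blast
  ultimately show ?thesis
    using fixed_imp_periodic periodic_imp_almost_periodic weakly_periodic_imp_recurrent
      periodic_imp_weakly_periodic[OF assms(2)] almost_periodic_imp_recurrent[OF assms(2)]
    by blast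
qed

end
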